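(* Let $G$ be a finite simple graph on $[n]$, and let $\Delta$ be the simplicial complex on $[n]$ with $I(\Delta)=J(G)$. Then $B(\Delta)$ is standard graded if and only if $A(\Delta)$ is standard graded.
   Context: Let $K$ be a field, $[n]=\{1,\ldots,n\}$ and $S=K[x_1,\ldots,x_n]$. A simplicial complex on $[n]$ is a nonempty collection of subsets (faces) of $[n]$ closed under taking subsets; facets are maximal faces. For $F\subseteq[n]$ put $x_F=\prod_{i\in F}x_i$. The facet ideal of $\Delta$ is $I(\Delta)=(x_F: F\text{ a facet of }\Delta)$. The cover ideal of $G$ is $J(G)=I(G)^\vee=\bigcap_{\{i,j\}\text{ edge of }G}(x_i,x_j)$, where $I(G)$ is the edge ideal of $G$; thus $I(\Delta)=J(G)$ means that the facets of $\Delta$ are exactly the minimal vertex covers of $G$. For $k\ge 0$, a $k$-cover of $\Delta$ is a nonzero vector $c\in\mathbb{Z}_{\ge 0}^n$ with $\sum_{i\in F}c_i\ge k$ for every facet $F$; it is squarefree if all $c_i\le 1$. Write $x^c=x_1^{c_1}\cdots x_n^{c_n}$. For $k\ge 1$, $J_k(\Delta)\subseteq S$ is the ideal spanned over $K$ by the monomials $x^c$ with $c$ a $k$-cover, $J_0(\Delta)=S$, and $A(\Delta)=\bigoplus_{k\ge 0}J_k(\Delta)t^k\subseteq S[t]$. $B(\Delta)\subseteq S[t]$ is the $S$-subalgebra generated by all $x^ct^k$ with $k\ge 1$ and $c$ a squarefree $k$-cover of $\Delta$. Both algebras are graded by the degree in $t$ (so $S$ is in degree $0$); such an algebra is standard graded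 if it is generated as an $S$-algebra by its elements of degree $1$. *)

theory Defs
  imports "HOL-Library.Poly_Mapping" "HOL-Computational_Algebra.Polynomial"
begin

text \<open>
  The index set $[n]$ is the universe of a finite type \<open>'v\<close>, with $n$ the cardinality of
  \<open>'v\<close>.  The ring $S = K[x_1,\dots,x_n]$ is then the whole type \<open>('v, 'k) mpoly\<close>, and
  $S[t]$ is the whole type \<open>('v, 'k) mpoly poly\<close>.
\<close>

type_synonym ('v, 'k) mpoly = "('v \<Rightarrow>\<^sub>0 nat) \<Rightarrow>\<^sub>0 'k"

definition var :: "'v \<Rightarrow> ('v, 'k::field) mpoly" where
  "var i = Poly_Mapping.single (Poly_Mapping.single i 1) 1"

definition const_mpoly :: "'k::field \<Rightarrow> ('v, 'k) mpoly" where
  "const_mpoly a = Poly_Mapping.single 0 a"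

definition xset :: "'v set \<Rightarrow> ('v, 'k::field) mpoly" where
  "xset F = (\<Prod>i\<in>F. var i)"

definition xpow :: "('v::finite \<Rightarrow> nat) \<Rightarrow> ('v, 'k::field) mpoly" where
  "xpow c = (\<Prod>i\<in>UNIV. var i ^ c i)"

definition ideal_gen :: "'s::comm_ring_1 set \<Rightarrow> 's set" where
  "ideal_gen X = module.span (*) X"

definition lin_span :: "('v, 'k::field) mpoly set \<Rightarrow> ('v, 'k) mpoly set" where
  "lin_span X = module.span (\<lambda>a p. const_mpoly a * p) X"

lemma module_times: "module ((*) :: 's::comm_ring_1 \<Rightarrow> 's \<Rightarrow> 's)"
  by unfold_locales (simp_all add: algebra_simps)

lemma vector_space_const_mpoly:
  "vector_space (\<lambda>(a::'k::field) (p::('v, 'k) mpoly). const_mpoly a * p)"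
  by unfold_locales
    (simp_all add: const_mpoly_def algebra_simps Poly_Mapping.single_add mult_single
      flip: mult.assoc)

definition simple_graph :: "'v set set \<Rightarrow> bool" where
  "simple_graph E \<longleftrightarrow> (\<forall>e\<in>E. card e = 2)"

definition cover_ideal :: "'v set set \<Rightarrow> ('v, 'k::field) mpoly set" where
  "cover_ideal E = \<Inter> {ideal_gen {var i, var j} | i j. {i, j} \<in> E}"

definition abstract_simplicial_complex :: "'v set set \<Rightarrow> bool" where
  "abstract_simplicial_complex \<Delta> \<longleftrightarrow> \<Delta> \<noteq> {} \<and> (\<forall>F\<in>\<Delta>. \<forall>F'\<subseteq>F. F' \<in> \<Delta>)"

definition facets :: "'v set set \<Rightarrow> 'v set set" where
  "facets \<Delta> = {F \<in> \<Delta>. \<forall>F'\<in>\<Delta>. F \<subseteq> F' \<longrightarrow> F' = F}"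

definition facet_ideal :: "'v set set \<Rightarrow> ('v, 'k::field) mpoly set" where
  "facet_ideal \<Delta> = ideal_gen (xset ` facets \<Delta>)"

definition is_cover :: "'v set set \<Rightarrow> nat \<Rightarrow> ('v \<Rightarrow> nat) \<Rightarrow> bool" where
  "is_cover \<Delta> k c \<longleftrightarrow> c \<noteq> (\<lambda>_. 0) \<and> (\<forall>F\<in>facets \<Delta>. k \<le> (\<Sum>i\<in>F. c i))"

definition squarefree_vec :: "('v \<Rightarrow> nat) \<Rightarrow> bool" where
  "squarefree_vec c \<longleftrightarrow> (\<forall>i. c i \<le> 1)"

text \<open>
  The case $k = 0$ is separate: the zero vector is not a $0$-cover, so the span of the
  monomials of $0$-covers would not contain $1$.
\<close>

definition J_ideal :: "'v::finite set set \<Rightarrow> nat \<Rightarrow> ('v, 'k::field) mpoly set" where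
  "J_ideal \<Delta> k = (if k = 0 then UNIV else lin_span {xpow c | c. is_cover \<Delta> k c})"

definition S_subalgebra :: "'s::comm_ring_1 poly set \<Rightarrow> bool" where
  "S_subalgebra R \<longleftrightarrow>
     (\<forall>f. [:f:] \<in> R) \<and> (\<forall>p\<in>R. \<forall>q\<in>R. p + q \<in> R) \<and> (\<forall>p\<in>R. \<forall>q\<in>R. p * q \<in> R)"

definition S_subalgebra_gen :: "'s::comm_ring_1 poly set \<Rightarrow> 's poly set" where
  "S_subalgebra_gen X = S_subalgebra hull X"

definition A_alg :: "'v::finite set set \<Rightarrow> ('v, 'k::field) mpoly poly set" where
  "A_alg \<Delta> = {p. \<forall>k. coeff p k \<in> J_ideal \<Delta> k}"

definition B_alg :: "'v::finite set set \<Rightarrow> ('v, 'k::field) mpoly poly set" where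
  "B_alg \<Delta> = S_subalgebra_gen
     {monom (xpow c) k | c k. 1 \<le> k \<and> is_cover \<Delta> k c \<and> squarefree_vec c}"

text \<open>The elements of degree $1$ of a graded subalgebra of $S[t]$ are its elements $f t$
  with \<open>f \<in> S\<close>.\<close>

definition standard_graded :: "'s::comm_ring_1 poly set \<Rightarrow> bool" where
  "standard_graded R \<longleftrightarrow> R = S_subalgebra_gen {p \<in> R. \<exists>f. p = monom f 1}"

end

theory Submission
  imports Defs
begin

text \<open>
  The degree-one part of $A(\Delta)$ is the edge ideal $I(G)$: a vector is a \<open>1\<close>-cover if and only
  if its support contains an edge.  Let $T$ be the subalgebra generated by this part, the Rees
  algebra of $I(G)$.  Its monomials $x^c t^k$ are those for which \<open>c\<close> dominates a sum of \<open>k\<close> edges.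
  Since the edges are themselves squarefree, $T \subseteq B(\Delta) \subseteq A(\Delta)$, all three
  algebras have the same part of degree one, and each of $A(\Delta)$, $B(\Delta)$ is standard graded
  if and only if it equals $T$ (lemma \<open>standard_graded_iff_eq_packing_algebra\<close>).

  So $A(\Delta) = T$ trivially implies $B(\Delta) = T$.  The converse is a matter of min-max duality
  between vertex covers and edge packings.  If $B(\Delta) = T$, every squarefree \<open>k\<close>-cover dominates
  a sum of \<open>k\<close> edges.  The vertex set of an odd cycle would be a squarefree cover violating this, so
  $G$ is bipartite (lemma \<open>bipartition_if_squarefree_packs\<close>).  For bipartite graphs duality
  holds for all weight vectors (lemma \<open>weighted_Koenig\<close>), which says that every monomial of
  $A(\Delta)$ lies in $T$.
\<close>

section \<open>Covers and packings of weighted graphs\<close>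

definition vertex_cover :: "'v set set \<Rightarrow> 'v set \<Rightarrow> bool" where
  "vertex_cover E F \<longleftrightarrow> (\<forall>e\<in>E. e \<inter> F \<noteq> {})"

text \<open>
  If the facets of $\Delta$ are the minimal vertex covers of $G$, then for $k \ge 1$ this is the
  condition that \<open>c\<close> is a \<open>k\<close>-cover of $\Delta$, now expressed through the graph.  Arbitrary covers
  are used in place of minimal ones because in a bipartite graph they form a lattice.
\<close>
definition min_cover_ge :: "'v set set \<Rightarrow> nat \<Rightarrow> ('v \<Rightarrow> nat) \<Rightarrow> bool" where
  "min_cover_ge E k c \<longleftrightarrow> (\<forall>F. vertex_cover E F \<longrightarrow> k \<le> sum c F)"

text \<open>
  Membership of $x^c$ in the power $I(G)^k$ of the edge ideal: \<open>c\<close> dominates the sum of the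
  indicator vectors of \<open>k\<close> edges, repetitions allowed.  The first rule lets \<open>c\<close> be arbitrary, so
  that the part of \<open>c\<close> left over by the edges needs no separate rule.
\<close>
inductive packs :: "'v set set \<Rightarrow> nat \<Rightarrow> ('v \<Rightarrow> nat) \<Rightarrow> bool" for E where
  packs_0: "packs E 0 c"
| packs_Suc: "e \<in> E \<Longrightarrow> packs E k c \<Longrightarrow> packs E (Suc k) (\<lambda>v. c v + of_bool (v \<in> e))"

lemma packs_add_right:
  assumes "packs E k c"
  shows "packs E k (\<lambda>v. c v + d v)"
  using assms
proof induction
  case (packs_Suc e k c)
  then have "packs E (Suc k) (\<lambda>v. (c v + d v) + of_bool (v \<in> e))"
    by (intro packs.packs_Suc)
  then show ?case by (simp add: add_ac)
qed (rule packs.packs_0)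

lemma packs_mono:
  assumes "packs E k c" and "\<And>v. c v \<le> d v"
  shows "packs E k d"
  using packs_add_right[OF assms(1), of "\<lambda>v. d v - c v"] assms(2) by simp

lemma packs_add:
  assumes "packs E k c" and "packs E l d"
  shows "packs E (k + l) (\<lambda>v. c v + d v)"
  using assms(1)
proof induction
  case (packs_0 c)
  show ?case using packs_mono[OF assms(2), of "\<lambda>v. c v + d v"] by simp
next
  case (packs_Suc e k c)
  then have "packs E (Suc (k + l)) (\<lambda>v. (c v + d v) + of_bool (v \<in> e))"
    by (intro packs.packs_Suc)
  then show ?case by (simp add: add_ac)
qed

text \<open>
  In this form the packing is built backwards: the edge \<open>e\<close> is removed from \<open>c\<close>, and it is
  the positivity of \<open>c\<close> on \<open>e\<close> that makes the truncated subtraction reversible.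
\<close>
lemma packs_Suc_of_diff:
  assumes "e \<in> E" "packs E k (\<lambda>v. c v - of_bool (v \<in> e))" "\<And>v. v \<in> e \<Longrightarrow> 0 < c v"
  shows "packs E (Suc k) c"
  using packs.packs_Suc[OF assms(1,2)]
  by (rule packs_mono) (use assms(3) in \<open>auto simp: Suc_le_eq\<close>)

text \<open>
  The easy half of min-max duality: a cover spends weight at least one on each packed edge.
\<close>
lemma min_cover_ge_if_packs:
  fixes E :: "'v::finite set set"
  assumes "packs E k c"
  shows "min_cover_ge E k c"
  using assms
proof induction
  case (packs_0 c)
  then show ?case by (simp add: min_cover_ge_def)
next
  case (packs_Suc e k c)
  show ?case unfolding min_cover_ge_def
  proof (intro allI impI)
    fix F assume F: "vertex_cover E F"
    then have "1 \<le> card (e \<inter> F)"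
      using packs_Suc.hyps by (simp add: vertex_cover_def Suc_le_eq card_gt_0_iff)
    also have "card (e \<inter> F) = (\<Sum>v\<in>F. of_bool (v \<in> e))"
      by (simp add: Int_commute)
    finally have "1 \<le> (\<Sum>v\<in>F. of_bool (v \<in> e) :: nat)" .
    moreover have "k \<le> sum c F"
      using packs_Suc.IH F by (simp add: min_cover_ge_def)
    ultimately show "Suc k \<le> (\<Sum>v\<in>F. c v + of_bool (v \<in> e))"
      by (simp only: sum.distrib)
  qed
qed

text \<open>
  The vertices of weight zero form a set of weight $0 < 1$, so they miss some edge; that edge lies
  in the support of \<open>c\<close>.  Thus the two notions agree in degree one for every graph.
\<close>
lemma packs_1_if_min_cover_ge:
  assumes "min_cover_ge E 1 c"
  shows "packs E 1 c"
proof -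
  have "\<not> vertex_cover E {v. c v = 0}"
    using assms by (force simp: min_cover_ge_def)
  then obtain e where "e \<in> E" "e \<inter> {v. c v = 0} = {}"
    by (metis vertex_cover_def)
  moreover from this have "0 < c v" if "v \<in> e" for v
    using that by auto
  ultimately show ?thesis
    unfolding One_nat_def by (intro packs_Suc_of_diff[OF _ packs.packs_0])
qed

lemma two_mult_le_sum_if_packs:
  fixes E :: "'v::finite set set"
  assumes "simple_graph E" "packs E k c"
  shows "2 * k \<le> sum c UNIV"
  using assms(2)
proof induction
  case (packs_Suc e k c)
  have "(\<Sum>v\<in>UNIV. of_bool (v \<in> e)) = card e" by simp
  also have "\<dots> = 2"
    using packs_Suc.hyps assms(1) by (simp add: simple_graph_def)
  finally have deg: "(\<Sum>v\<in>UNIV. of_bool (v \<in> e)) = (2::nat)" .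
  have "2 * Suc k \<le> sum c UNIV + 2" using packs_Suc.IH by simp
  also have "\<dots> = (\<Sum>v\<in>UNIV. c v + of_bool (v \<in> e))"
    by (simp only: sum.distrib deg)
  finally show ?case .
qed simp

section \<open>Bipartite graphs and odd closed walks\<close>

definition adj :: "'v set set \<Rightarrow> ('v \<times> 'v) set" where
  "adj E = {(u, v). {u, v} \<in> E}"

lemma sym_adj_relpow:
  assumes "(u, v) \<in> adj E ^^ n"
  shows "(v, u) \<in> adj E ^^ n"
  using assms
proof (induction n arbitrary: v)
  case (Suc n)
  then obtain w where "(w, u) \<in> adj E ^^ n" "(v, w) \<in> adj E"
    by (auto simp: adj_def insert_commute)
  then show ?case by (rule relpow_Suc_I2[rotated])
qed simp

definition bipartition :: "'v set set \<Rightarrow> 'v set \<Rightarrow> bool" where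
  "bipartition E A \<longleftrightarrow> (\<forall>e\<in>E. \<exists>u\<in>A. \<exists>v. v \<notin> A \<and> e = {u, v})"

text \<open>
  Fix a root in each connected component and put a vertex into \<open>A\<close> if it can be reached from its
  root in an even number of steps.  If two walks from a root to the same vertex had lengths of different
  parity, or if the ends of an edge received the same colour, the walks would combine to an odd
  closed walk.
\<close>
lemma bipartition_if_no_odd_closed_walk:
  assumes "simple_graph E" and no_odd: "\<And>n v. odd n \<Longrightarrow> (v, v) \<notin> adj E ^^ n"
  shows "\<exists>A. bipartition E A"
proof -
  define r where "r v = (SOME u. (v, u) \<in> (adj E)\<^sup>*)" for v
  have sym: "(u, v) \<in> (adj E)\<^sup>* \<Longrightarrow> (v, u) \<in> (adj E)\<^sup>*" for u v
    by (metis rtrancl_power sym_adj_relpow)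
  have r: "(v, r v) \<in> (adj E)\<^sup>*" for v
    unfolding r_def by (rule someI[of _ v]) simp
  have r_eq: "r u = r v" if "(u, v) \<in> adj E" for u v
  proof -
    have "(u, w) \<in> (adj E)\<^sup>* \<longleftrightarrow> (v, w) \<in> (adj E)\<^sup>*" for w
      using that sym by (meson r_into_rtrancl rtrancl_trans)
    then show ?thesis by (simp add: r_def)
  qed
  define A where "A = {v. \<exists>n. even n \<and> (r v, v) \<in> adj E ^^ n}"
  have colour: "(u \<in> A) \<noteq> (v \<in> A)" if uv: "(u, v) \<in> adj E" for u v
  proof -
    obtain m n where m: "(r u, u) \<in> adj E ^^ m" and n: "(r v, v) \<in> adj E ^^ n"
      using r sym by (meson rtrancl_power)
    have par: "odd (a + b)" if "(r u, u) \<in> adj E ^^ a" "(r v, v) \<in> adj E ^^ b" for a b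
    proof (rule ccontr)
      assume "\<not> odd (a + b)"
      moreover have "(r u, v) \<in> adj E ^^ Suc a" using that(1) uv by auto
      then have "(r u, r u) \<in> adj E ^^ (Suc a + b)"
        using sym_adj_relpow[OF that(2)] r_eq[OF uv] by (metis relpow_add relcompI)
      ultimately show False using no_odd by (metis add_Suc even_Suc)
    qed
    have "u \<in> A \<longleftrightarrow> even m"
    proof -
      have "even a \<longleftrightarrow> even m" if "(r u, u) \<in> adj E ^^ a" for a
        using par[OF m n] par[OF that n] by simp
      then show ?thesis using m unfolding A_def by blast
    qed
    moreover have "v \<in> A \<longleftrightarrow> even n"
    proof -
      have "even b \<longleftrightarrow> even n" if "(r v, v) \<in> adj E ^^ b" for b
        using par[OF m n] par[OF m that] by simp
      then show ?thesis using n unfolding A_def by blast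
    qed
    ultimately show ?thesis using par[OF m n] by auto
  qed
  have "bipartition E A"
    unfolding bipartition_def
  proof (intro ballI)
    fix e assume "e \<in> E"
    then obtain u v where uv: "e = {u, v}"
      using assms(1) unfolding simple_graph_def card_2_iff by blast
    then have "(u, v) \<in> adj E" using \<open>e \<in> E\<close> by (simp add: adj_def)
    then have "(u \<in> A) \<noteq> (v \<in> A)" by (rule colour)
    moreover have "e = {v, u}" using uv by (simp add: insert_commute)
    ultimately show "\<exists>u\<in>A. \<exists>v. v \<notin> A \<and> e = {u, v}"
      using uv by blast
  qed
  then show ?thesis by blast
qed

text \<open>
  A closed walk that repeats a vertex splits there into two shorter closed walks, and if its length
  is odd, then so is the length of one of them.  A shortest one therefore has no repetition.
\<close>
lemma shortest_odd_closed_walk: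
  assumes "odd n" "(v, v) \<in> adj E ^^ n"
  obtains w m where "odd m" "w m = w 0" "\<forall>i<m. {w i, w (Suc i)} \<in> E"
    "inj_on w {..<m}"
proof -
  define P where "P m \<longleftrightarrow> odd m \<and> (\<exists>v. (v, v) \<in> adj E ^^ m)" for m
  define m where "m = (LEAST m. P m)"
  have "P n" using assms by (auto simp: P_def)
  then have "P m" unfolding m_def by (rule LeastI)
  have least: "m \<le> l" if "P l" for l
    unfolding m_def using that by (rule Least_le)
  from \<open>P m\<close> obtain v where "odd m" "(v, v) \<in> adj E ^^ m" by (auto simp: P_def)
  then obtain w where w: "w 0 = v" "w m = v" "\<And>i. i < m \<Longrightarrow> (w i, w (Suc i)) \<in> adj E"
    by (auto simp: relpow_fun_conv)
  have seg: "(w i, w j) \<in> adj E ^^ (j - i)" if "i \<le> j" "j \<le> m" for i j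
    unfolding relpow_fun_conv by (rule exI[of _ "\<lambda>k. w (i + k)"]) (use that w(3) in auto)
  have neq: "w i \<noteq> w j" if ij: "i < j" "j < m" for i j
  proof
    assume eq: "w i = w j"
    have "(w i, w i) \<in> adj E ^^ (j - i)"
      using seg[of i j] ij eq by simp
    moreover have "(w 0, w m) \<in> adj E ^^ (i + (m - j))"
      using seg[of 0 i] seg[of j m] ij eq unfolding relpow_add by (auto intro: relcompI)
    moreover have "odd (j - i) \<or> odd (i + (m - j))"
      using \<open>odd m\<close> ij by auto
    ultimately have "P (j - i) \<or> P (i + (m - j))"
      using w by (auto simp: P_def)
    then show False using least[of "j - i"] least[of "i + (m - j)"] ij by auto
  qed
  have "inj_on w {..<m}"
    by (rule linorder_inj_onI) (use neq in auto)
  then show thesis using that[of m w] \<open>odd m\<close> w by (auto simp: adj_def)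
qed

text \<open>
  An odd cycle on $m$ vertices has no vertex cover with fewer than $(m+1)/2$ elements, whereas
  $(m+1)/2$ disjoint edges would need $m+1$ vertices.  Hence the indicator vector of the vertex
  set of an odd cycle violates min-max duality, and it is squarefree.
\<close>
lemma bipartition_if_squarefree_packs:
  fixes E :: "'v::finite set set"
  assumes "simple_graph E"
    and packs: "\<And>k c. squarefree_vec c \<Longrightarrow> min_cover_ge E k c \<Longrightarrow> packs E k c"
  shows "\<exists>A. bipartition E A"
proof (rule bipartition_if_no_odd_closed_walk[OF assms(1)])
  fix n v assume "odd (n::nat)"
  show "(v, v) \<notin> adj E ^^ n"
  proof
    assume "(v, v) \<in> adj E ^^ n"
    with \<open>odd n\<close> obtain w m where w: "odd m" "w m = w 0"
      "\<forall>i<m. {w i, w (Suc i)} \<in> E" "inj_on w {..<m}"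
      by (rule shortest_odd_closed_walk)
    define c where "c v = (of_bool (v \<in> w ` {..<m}) :: nat)" for v
    have sum_c: "sum c F = (\<Sum>i<m. of_bool (w i \<in> F))" for F
    proof -
      have "sum c F = (\<Sum>v\<in>w ` {..<m}. of_bool (v \<in> F))"
        by (simp add: c_def Int_commute)
      also have "\<dots> = (\<Sum>i<m. of_bool (w i \<in> F))"
        by (rule sum.reindex_cong[OF w(4)]) auto
      finally show ?thesis .
    qed
    have "min_cover_ge E (Suc (m div 2)) c"
      unfolding min_cover_ge_def
    proof (intro allI impI)
      fix F assume F: "vertex_cover E F"
      define f where "f i = (of_bool (w i \<in> F) :: nat)" for i
      \<comment> \<open>Each edge of the cycle meets \<open>F\<close>, and each vertex of the cycle lies on two of its edges.\<close>
      have "m = (\<Sum>i<m. 1)" by simp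
      also have "\<dots> \<le> (\<Sum>i<m. f i + f (Suc i))"
      proof (rule sum_mono)
        fix i assume "i \<in> {..<m}"
        then have "{w i, w (Suc i)} \<in> E" using w(3) by simp
        then have "{w i, w (Suc i)} \<inter> F \<noteq> {}"
          using F by (metis vertex_cover_def)
        then show "1 \<le> f i + f (Suc i)" by (auto simp: f_def)
      qed
      also have "\<dots> = (\<Sum>i<m. f i) + (\<Sum>i<m. f (Suc i))" by (rule sum.distrib)
      also have "(\<Sum>i<m. f (Suc i)) = (\<Sum>i<m. f i)"
      proof -
        have "f 0 + (\<Sum>i<m. f (Suc i)) = (\<Sum>i<m. f i) + f m"
          by (metis sum.lessThan_Suc sum.lessThan_Suc_shift)
        then show ?thesis using w(2) by (simp add: f_def)
      qed
      also have "(\<Sum>i<m. f i) = sum c F" by (simp add: sum_c f_def)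
      finally show "Suc (m div 2) \<le> sum c F" using w(1) by presburger
    qed
    moreover have "squarefree_vec c" by (simp add: squarefree_vec_def c_def)
    ultimately have "2 * Suc (m div 2) \<le> sum c UNIV"
      by (intro two_mult_le_sum_if_packs[OF assms(1)] packs)
    then show False using w(1) by (simp add: sum_c)
  qed
qed

section \<open>The weighted theorem of Koenig\<close>

text \<open>
  The proof is by induction on the total weight, and either lowers the weight of one vertex or
  splits off an edge.  Call a cover tight if its weight is exactly \<open>k\<close>, and choose a vertex
  \<open>i \<in> A\<close> of positive weight.  If no tight cover contains \<open>i\<close>, the weight of \<open>i\<close> can be lowered.
  Otherwise an edge \<open>{i, j}\<close> in the support is sought such that no tight cover contains both ends:
  removing it then leaves each cover a weight of at least \<open>k - 1\<close>.

  In a bipartite graph the covers form a lattice (intersect on one side, unite on the other side),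
  weight is modular on it, and so tight covers are closed under its operations.  Hence among the
  tight covers containing \<open>i\<close> there is one, \<open>F\<close>, whose trace outside \<open>A\<close> includes that of all the
  others, and every edge \<open>{i, j}\<close> in the support with \<open>j \<notin> F\<close> will do.  There is such an edge, since
  otherwise \<open>F - {i}\<close> together with the vertices of weight zero would be a cover of weight less
  than \<open>k\<close>.
\<close>
lemma weighted_Koenig:
  fixes E :: "'v::finite set set"
  assumes bip: "bipartition E A" and "min_cover_ge E k c"
  shows "packs E k c"
  using assms(2)
proof (induction "sum c UNIV" arbitrary: c k rule: less_induct)
  case less
  show ?case
  proof (cases k)
    case 0
    then show ?thesis by (simp add: packs.packs_0)
  next
    case (Suc l)
    have ge: "k \<le> sum c F" if "vertex_cover E F" for F
      using less.prems that by (simp add: min_cover_ge_def)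
    have "vertex_cover E A"
      using bip by (fastforce simp: bipartition_def vertex_cover_def)
    with ge Suc have "sum c A > 0" by fastforce
    then obtain i where i: "i \<in> A" "0 < c i"
      by (metis gr0I less_irrefl sum.neutral)
    define tight where "tight F \<longleftrightarrow> vertex_cover E F \<and> sum c F = k" for F
    show ?thesis
    proof (cases "\<exists>F. tight F \<and> i \<in> F")
      case False
      let ?c = "c(i := c i - 1)"
      have sum_c: "sum c F = sum ?c F + of_bool (i \<in> F)" for F
      proof -
        have "sum c F = (\<Sum>v\<in>F. ?c v + of_bool (v = i))"
          by (rule sum.cong) (use i in auto)
        then show ?thesis by (simp add: sum.distrib)
      qed
      have "min_cover_ge E k ?c"
        unfolding min_cover_ge_def
      proof (intro allI impI)
        fix F assume "vertex_cover E F"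
        then have "k \<le> sum c F" "i \<in> F \<Longrightarrow> sum c F \<noteq> k"
          using False ge[of F] by (auto simp: tight_def)
        then show "k \<le> sum ?c F"
          using sum_c[of F] by (cases "i \<in> F") (simp_all del: fun_upd_apply)
      qed
      then have "packs E k ?c"
        using less.hyps[of ?c k] sum_c[of UNIV] by simp
      then show ?thesis by (rule packs_mono) simp
    next
      case True
      obtain F where F: "tight F" "i \<in> F"
        and F_max: "\<And>F'. tight F' \<Longrightarrow> i \<in> F' \<Longrightarrow> card (F' - A) \<le> card (F - A)"
      proof -
        have "\<forall>F. tight F \<and> i \<in> F \<longrightarrow> card (F - A) < Suc (card (UNIV :: 'v set))"
          by (simp add: less_Suc_eq_le card_mono)
        with True show thesis
          using ex_has_greatest_nat[of "\<lambda>F. tight F \<and> i \<in> F" _ "\<lambda>F. card (F - A)"] that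
          by blast
      qed
      \<comment> \<open>The meet of \<open>F\<close> and \<open>F'\<close> contains both traces outside \<open>A\<close>, so maximality absorbs \<open>F'\<close>.\<close>
      have sub: "F' - A \<subseteq> F" if F': "tight F'" "i \<in> F'" for F'
      proof -
        \<comment> \<open>Meet and join of the two covers in the lattice of covers.\<close>
        define M where "M = (F \<inter> F' \<inter> A) \<union> ((F \<union> F') - A)"
        define N where "N = ((F \<union> F') \<inter> A) \<union> (F \<inter> F' - A)"
        have "e \<inter> M \<noteq> {} \<and> e \<inter> N \<noteq> {}" if "e \<in> E" for e
        proof -
          obtain u v where "u \<in> A" "v \<notin> A" "e = {u, v}"
            using bip \<open>e \<in> E\<close> unfolding bipartition_def by blast
          moreover have "e \<inter> F \<noteq> {}" "e \<inter> F' \<noteq> {}"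
            using F(1) F'(1) \<open>e \<in> E\<close> by (simp_all add: tight_def vertex_cover_def)
          ultimately show ?thesis unfolding M_def N_def by auto
        qed
        then have "vertex_cover E M" "vertex_cover E N"
          by (simp_all add: vertex_cover_def)
        moreover have "sum c M + sum c N = sum c F + sum c F'"
        proof -
          have "sum c (M \<union> N) + sum c (M \<inter> N) = sum c (F \<union> F') + sum c (F \<inter> F')"
            by (intro arg_cong2[of _ _ _ _ "(+)"] sum.cong) (auto simp: M_def N_def)
          then show ?thesis
            using sum.union_inter[of M N c] sum.union_inter[of F F' c] by simp
        qed
        ultimately have "tight M"
          using F(1) F'(1) ge[of M] ge[of N] by (auto simp: tight_def)
        moreover have "i \<in> M" using i F F' by (simp add: M_def)
        ultimately have "card (M - A) \<le> card (F - A)" by (rule F_max)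
        moreover have "F - A \<subseteq> M - A" by (auto simp: M_def)
        ultimately have "F - A = M - A" by (intro card_seteq) auto
        then show ?thesis by (auto simp: M_def)
      qed
      have "\<not> vertex_cover E ((F - {i}) \<union> {v. c v = 0})"
      proof
        assume "vertex_cover E ((F - {i}) \<union> {v. c v = 0})"
        then have "k \<le> sum c ((F - {i}) \<union> {v. c v = 0})" by (rule ge)
        also have "\<dots> = sum c (F - {i})"
          by (rule sum.mono_neutral_right) auto
        also have "\<dots> < sum c F"
          using F(2) i by (simp add: sum.remove[of F i])
        finally show False using F(1) by (simp add: tight_def)
      qed
      then obtain e where e: "e \<in> E" "e \<inter> ((F - {i}) \<union> {v. c v = 0}) = {}"
        by (metis vertex_cover_def)
      then have e': "e \<inter> (F - {i}) = {}" "\<forall>v\<in>e. 0 < c v" by auto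
      moreover have "e \<inter> F \<noteq> {}" using F(1) e(1) by (simp add: tight_def vertex_cover_def)
      ultimately have "i \<in> e" by blast
      obtain u j where uj: "u \<in> A" "j \<notin> A" "e = {u, j}"
        using bip e(1) unfolding bipartition_def by blast
      have "i \<noteq> j" using i(1) uj(2) by blast
      with uj(3) \<open>i \<in> e\<close> have "e = {i, j}" by simp
      moreover have "j \<notin> F" using e'(1) uj(3) \<open>i \<noteq> j\<close> by blast
      ultimately have j: "e = {i, j}" "j \<notin> A" "j \<notin> F" using uj(2) by simp_all
      let ?c = "\<lambda>v. c v - of_bool (v \<in> e)"
      have sum_c: "sum c F = sum ?c F + card (F \<inter> e)" for F
      proof -
        have "sum c F = (\<Sum>v\<in>F. ?c v + of_bool (v \<in> e))"
          by (rule sum.cong) (use e'(2) in \<open>auto simp: Suc_le_eq\<close>)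
        also have "\<dots> = sum ?c F + (\<Sum>v\<in>F. of_bool (v \<in> e))" by (rule sum.distrib)
        finally show ?thesis by simp
      qed
      have "min_cover_ge E l ?c"
        unfolding min_cover_ge_def
      proof (intro allI impI)
        fix F' assume F': "vertex_cover E F'"
        show "l \<le> sum ?c F'"
        \<comment> \<open>Only a cover containing both ends loses weight two, and by the choice of \<open>F\<close> it is not tight.\<close>
        proof (cases "e \<subseteq> F'")
          case True
          then have "i \<in> F'" "j \<in> F' - A" using j by simp_all
          then have "\<not> tight F'" using sub[of F'] j(3) by blast
          then have "k < sum c F'" using ge[OF F'] F' by (simp add: tight_def)
          moreover have "card (F' \<inter> e) \<le> 2"
            using j(1) \<open>i \<noteq> j\<close> card_mono[of e "F' \<inter> e"] by simp
          ultimately show ?thesis using sum_c[of F'] Suc by simp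
        next
          case False
          then have "F' \<inter> e \<subset> e" by blast
          then have "card (F' \<inter> e) < card e" by (rule psubset_card_mono[rotated]) simp
          then have "card (F' \<inter> e) \<le> 1" using j \<open>i \<noteq> j\<close> by simp
          then show ?thesis using sum_c[of F'] ge[OF F'] Suc by simp
        qed
      qed
      moreover have "sum ?c UNIV < sum c UNIV"
        using sum_c[of UNIV] j by (simp add: card_gt_0_iff)
      ultimately have "packs E l ?c" by (intro less.hyps)
      then show ?thesis
        unfolding Suc by (rule packs_Suc_of_diff[OF e(1)]) (simp add: e'(2))
    qed
  qed
qed

section \<open>Monomials and monomial ideals\<close>

lemma prod_single_eq_single_sum:
  "(\<Prod>i\<in>A. Poly_Mapping.single (f i) 1) = (Poly_Mapping.single (\<Sum>i\<in>A. f i) 1 :: ('v, 'k::field) mpoly)"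
  by (induction A rule: infinite_finite_induct) (auto simp: mult_single)

lemma single_power_eq_single_sum:
  "Poly_Mapping.single m 1 ^ n = (Poly_Mapping.single (\<Sum>i<n. m) 1 :: ('v, 'k::field) mpoly)"
  by (induction n) (auto simp: mult_single add.commute)

lemma xpow_lookup:
  "(xpow (Poly_Mapping.lookup m) :: ('v::finite, 'k::field) mpoly) = Poly_Mapping.single m 1"
proof -
  have "(\<Sum>i\<in>UNIV. \<Sum>_<Poly_Mapping.lookup m i. Poly_Mapping.single i 1) = m"
    by (rule poly_mapping_eqI)
      (simp add: lookup_sum lookup_single when_def if_distrib[where f = "(*) _"] cong: if_cong)
  then show ?thesis
    by (simp add: xpow_def var_def single_power_eq_single_sum prod_single_eq_single_sum)
qed

lemma ex_lookup_eq: "\<exists>m. Poly_Mapping.lookup m = (c :: 'v::finite \<Rightarrow> nat)"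
  by (rule exI[of _ "Abs_poly_mapping c"]) (simp add: Abs_poly_mapping_inverse)

lemma xset_eq_xpow: "(xset F :: ('v::finite, 'k::field) mpoly) = xpow (\<lambda>v. of_bool (v \<in> F))"
  unfolding xset_def xpow_def by (rule prod.mono_neutral_cong_left) auto

lemma xset_eq_single:
  obtains m where "(xset F :: ('v::finite, 'k::field) mpoly) = Poly_Mapping.single m 1"
    and "Poly_Mapping.lookup m = (\<lambda>v. of_bool (v \<in> F))"
  using ex_lookup_eq xset_eq_xpow xpow_lookup by metis

lemma mpoly_eq_sum_monomials:
  fixes p :: "('v, 'k::field) mpoly"
  shows "p = (\<Sum>m\<in>Poly_Mapping.keys p. const_mpoly (Poly_Mapping.lookup p m) * Poly_Mapping.single m 1)"
  unfolding const_mpoly_def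
  by (rule poly_mapping_eqI)
    (simp add: lookup_sum mult_single lookup_single when_def in_keys_iff)

lemma keys_multE:
  fixes p q :: "('v, 'k::field) mpoly"
  assumes "m \<in> Poly_Mapping.keys (p * q)"
  obtains a b where "m = a + b" "a \<in> Poly_Mapping.keys p" "b \<in> Poly_Mapping.keys q"
  using assms keys_mult[of p q] by auto

text \<open>
  The polynomials all of whose monomials are divisible by one of the generators form an ideal.
\<close>
lemma xset_mem_ideal_gen_iff:
  "(xset F :: ('v::finite, 'k::field) mpoly) \<in> ideal_gen (xset ` \<F>) \<longleftrightarrow> (\<exists>H\<in>\<F>. H \<subseteq> F)"
proof
  let ?I = "{p :: ('v, 'k) mpoly. \<forall>m\<in>Poly_Mapping.keys p.
    \<exists>H\<in>\<F>. \<forall>v\<in>H. 0 < Poly_Mapping.lookup m v}"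
  assume "(xset F :: ('v, 'k) mpoly) \<in> ideal_gen (xset ` \<F>)"
  also have "ideal_gen (xset ` \<F>) \<subseteq> ?I"
    unfolding ideal_gen_def
  proof (rule module.span_minimal[OF module_times])
    show "xset ` \<F> \<subseteq> ?I"
    proof (rule image_subsetI)
      fix H assume "H \<in> \<F>"
      moreover obtain m where "(xset H :: ('v, 'k) mpoly) = Poly_Mapping.single m 1"
        "Poly_Mapping.lookup m = (\<lambda>v. of_bool (v \<in> H))"
        by (rule xset_eq_single)
      ultimately show "xset H \<in> ?I" by auto
    qed
    show "module.subspace (*) ?I"
    proof (rule module.subspaceI[OF module_times])
      show "0 \<in> ?I" by simp
    next
      fix p q assume "p \<in> ?I" "q \<in> ?I"
      then show "p + q \<in> ?I" using Poly_Mapping.keys_add[of p q] by blast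
    next
      fix f p assume "p \<in> ?I"
      show "f * p \<in> ?I"
      proof safe
        fix m assume "m \<in> Poly_Mapping.keys (f * p)"
        then obtain a b where m: "m = a + b" "b \<in> Poly_Mapping.keys p" by (rule keys_multE)
        then obtain H where "H \<in> \<F>" "\<forall>v\<in>H. 0 < Poly_Mapping.lookup b v"
          using \<open>p \<in> ?I\<close> by blast
        then show "\<exists>H\<in>\<F>. \<forall>v\<in>H. 0 < Poly_Mapping.lookup m v"
          unfolding m(1) lookup_add by (metis add_pos_nonneg add.commute zero_le)
      qed
    qed
  qed
  finally have "\<forall>m\<in>Poly_Mapping.keys (xset F :: ('v, 'k) mpoly).
    \<exists>H\<in>\<F>. \<forall>v\<in>H. 0 < Poly_Mapping.lookup m v" by simp
  moreover obtain m where m: "(xset F :: ('v, 'k) mpoly) = Poly_Mapping.single m 1"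
    "Poly_Mapping.lookup m = (\<lambda>v. of_bool (v \<in> F))"
    by (rule xset_eq_single)
  ultimately obtain H where "H \<in> \<F>" "\<forall>v\<in>H. v \<in> F" by auto
  then show "\<exists>H\<in>\<F>. H \<subseteq> F" by blast
next
  assume "\<exists>H\<in>\<F>. H \<subseteq> F"
  then obtain H where "H \<in> \<F>" "H \<subseteq> F" by blast
  then have "xset F = xset (F - H) * (xset H :: ('v, 'k) mpoly)"
    unfolding xset_def by (simp add: prod.subset_diff)
  moreover have "xset (F - H) * (xset H :: ('v, 'k) mpoly) \<in> ideal_gen (xset ` \<F>)"
    unfolding ideal_gen_def using \<open>H \<in> \<F>\<close>
    by (intro module.span_scale[OF module_times] module.span_base[OF module_times] imageI)
  ultimately show "(xset F :: ('v, 'k) mpoly) \<in> ideal_gen (xset ` \<F>)" by simp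
qed

lemma xset_mem_cover_ideal_iff:
  assumes "simple_graph E"
  shows "(xset F :: ('v::finite, 'k::field) mpoly) \<in> cover_ideal E \<longleftrightarrow> vertex_cover E F"
proof -
  have "(xset F :: ('v, 'k) mpoly) \<in> ideal_gen {var i, var j} \<longleftrightarrow> {i, j} \<inter> F \<noteq> {}" for i j
    using xset_mem_ideal_gen_iff[of F "{{i}, {j}}", where ?'k='k] by (auto simp: xset_def)
  then have "(xset F :: ('v, 'k) mpoly) \<in> cover_ideal E \<longleftrightarrow> (\<forall>i j. {i, j} \<in> E \<longrightarrow> {i, j} \<inter> F \<noteq> {})"
    unfolding cover_ideal_def by blast
  moreover have "\<exists>i j. e = {i, j}" if "e \<in> E" for e
    using assms that unfolding simple_graph_def card_2_iff by blast
  ultimately show ?thesis unfolding vertex_cover_def by metis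
qed

text \<open>
  Comparing which monomials $x_F$ lie in the facet ideal and in the cover ideal shows that the
  vertex covers are exactly the sets that contain a facet.  The set of all vertices is a cover, so
  for \<open>0 < k\<close> the vector zero is excluded automatically.
\<close>
lemma is_cover_iff_min_cover_ge:
  fixes E \<Delta> :: "'v::finite set set"
  assumes "simple_graph E"
    and "(facet_ideal \<Delta> :: ('v, 'k::field) mpoly set) = cover_ideal E"
    and "0 < k"
  shows "is_cover \<Delta> k c \<longleftrightarrow> min_cover_ge E k c"
proof -
  have cover: "vertex_cover E F \<longleftrightarrow> (\<exists>H\<in>facets \<Delta>. H \<subseteq> F)" for F
    using xset_mem_cover_ideal_iff[OF assms(1), of F, where ?'k='k]
      xset_mem_ideal_gen_iff[of F "facets \<Delta>", where ?'k='k]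
    by (simp add: facet_ideal_def flip: assms(2))
  have "(\<forall>F\<in>facets \<Delta>. k \<le> sum c F) \<longleftrightarrow> min_cover_ge E k c"
  proof
    assume facets: "\<forall>F\<in>facets \<Delta>. k \<le> sum c F"
    show "min_cover_ge E k c"
      unfolding min_cover_ge_def
    proof (intro allI impI)
      fix F assume "vertex_cover E F"
      then obtain H where "H \<in> facets \<Delta>" "H \<subseteq> F" using cover by blast
      then show "k \<le> sum c F" using facets sum_mono2[of F H c] by fastforce
    qed
  qed (auto simp: min_cover_ge_def cover)
  moreover have "c \<noteq> (\<lambda>_. 0)" if "min_cover_ge E k c"
  proof -
    have "vertex_cover E UNIV"
      using assms(1) by (auto simp: vertex_cover_def simple_graph_def)
    then show ?thesis using that assms(3) by (auto simp: min_cover_ge_def)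
  qed
  ultimately show ?thesis unfolding is_cover_def by blast
qed

section \<open>Monomial subalgebras\<close>

lemma S_subalgebra_gen_is_S_subalgebra: "S_subalgebra (S_subalgebra_gen X)"
  unfolding S_subalgebra_gen_def by (rule hull_in) (auto simp: S_subalgebra_def)

definition monomial_algebra ::
  "(nat \<Rightarrow> ('v \<Rightarrow> nat) \<Rightarrow> bool) \<Rightarrow> ('v, 'k::field) mpoly poly set" where
  "monomial_algebra P =
     {p. \<forall>k. \<forall>m\<in>Poly_Mapping.keys (coeff p k). P k (Poly_Mapping.lookup m)}"

lemma S_subalgebra_monomial_algebra:
  assumes "\<And>c. P 0 c"
    and "\<And>k l c d. P k c \<Longrightarrow> P l d \<Longrightarrow> P (k + l) (\<lambda>v. c v + d v)"
  shows "S_subalgebra (monomial_algebra P :: ('v, 'k::field) mpoly poly set)"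
  unfolding S_subalgebra_def
proof (intro conjI allI ballI)
  fix f :: "('v, 'k) mpoly"
  show "[:f:] \<in> monomial_algebra P"
    by (auto simp: monomial_algebra_def coeff_pCons assms(1) split: nat.splits)
next
  fix p q :: "('v, 'k) mpoly poly"
  assume p: "p \<in> monomial_algebra P" and q: "q \<in> monomial_algebra P"
  have "P k (Poly_Mapping.lookup m)" if "m \<in> Poly_Mapping.keys (coeff p k + coeff q k)" for k m
    using p q that Poly_Mapping.keys_add[of "coeff p k" "coeff q k"]
    unfolding monomial_algebra_def by blast
  then show "p + q \<in> monomial_algebra P"
    by (simp add: monomial_algebra_def)
  have "P k (Poly_Mapping.lookup m)" if m: "m \<in> Poly_Mapping.keys (coeff (p * q) k)" for k m
  proof -
    have "m \<in> (\<Union>i\<le>k. Poly_Mapping.keys (coeff p i * coeff q (k - i)))"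
      using m Poly_Mapping.keys_sum[of "\<lambda>i. coeff p i * coeff q (k - i)" "{..k}"]
      by (auto simp: coeff_mult)
    then obtain i where i: "i \<le> k" "m \<in> Poly_Mapping.keys (coeff p i * coeff q (k - i))"
      by blast
    obtain a b where "m = a + b" "a \<in> Poly_Mapping.keys (coeff p i)"
        "b \<in> Poly_Mapping.keys (coeff q (k - i))"
      using i(2) by (rule keys_multE)
    moreover from this have "P (i + (k - i)) (\<lambda>v. Poly_Mapping.lookup a v + Poly_Mapping.lookup b v)"
      using p q by (intro assms(2)) (auto simp: monomial_algebra_def)
    moreover have "Poly_Mapping.lookup (a + b) = (\<lambda>v. Poly_Mapping.lookup a v + Poly_Mapping.lookup b v)"
      by (auto simp: lookup_add)
    ultimately show ?thesis using i(1) by simp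
  qed
  then show "p * q \<in> monomial_algebra P"
    by (simp add: monomial_algebra_def)
qed

lemma monom_xpow_mem_monomial_algebra_iff:
  "(monom (xpow c) k :: ('v::finite, 'k::field) mpoly poly) \<in> monomial_algebra P
     \<longleftrightarrow> P k c"
proof -
  obtain m where "c = Poly_Mapping.lookup m" using ex_lookup_eq by metis
  then show ?thesis by (simp add: monomial_algebra_def xpow_lookup)
qed

lemma S_subalgebra_sum:
  assumes "S_subalgebra R" "\<And>i. i \<in> I \<Longrightarrow> f i \<in> R"
  shows "sum f I \<in> R"
  using assms(2)
proof (induction I rule: infinite_finite_induct)
  case (insert i I)
  then show ?case using assms(1) by (simp add: S_subalgebra_def)
qed (use assms(1) in \<open>metis S_subalgebra_def pCons_0_0 sum.infinite sum.empty\<close>)+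

lemma S_subalgebra_smult:
  assumes "S_subalgebra R" "p \<in> R"
  shows "smult f p \<in> R"
proof -
  have "[:f:] * p \<in> R" using assms unfolding S_subalgebra_def by blast
  then show ?thesis by simp
qed

text \<open>
  A polynomial in $S[t]$ is a $K$-linear combination of the monomials $x^c t^k$ that occur in it.
\<close>
lemma monomial_algebra_subset:
  fixes R :: "('v::finite, 'k::field) mpoly poly set"
  assumes "S_subalgebra R" and monom: "\<And>k c. P k c \<Longrightarrow> monom (xpow c) k \<in> R"
  shows "monomial_algebra P \<subseteq> R"
proof
  fix p :: "('v, 'k) mpoly poly"
  assume p: "p \<in> monomial_algebra P"
  have "monom (coeff p k) k \<in> R" for k
  proof -
    let ?f = "\<lambda>m. smult (const_mpoly (Poly_Mapping.lookup (coeff p k) m)) (monom (xpow (Poly_Mapping.lookup m)) k)"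
    have "(\<Sum>m\<in>Poly_Mapping.keys (coeff p k). ?f m) \<in> R"
      using p by (intro S_subalgebra_sum[OF assms(1)] S_subalgebra_smult[OF assms(1)] monom)
        (simp add: monomial_algebra_def)
    also have "(\<Sum>m\<in>Poly_Mapping.keys (coeff p k). ?f m) = monom (coeff p k) k"
      by (subst (4) mpoly_eq_sum_monomials) (simp add: monom_sum smult_monom xpow_lookup)
    finally show ?thesis .
  qed
  then have "(\<Sum>k\<le>degree p. monom (coeff p k) k) \<in> R"
    by (intro S_subalgebra_sum[OF assms(1)])
  then show "p \<in> R" by (simp add: poly_as_sum_of_monoms)
qed

lemma lin_span_monomials:
  "lin_span {xpow c | c. Q c} =
     {p :: ('v::finite, 'k::field) mpoly. \<forall>m\<in>Poly_Mapping.keys p. Q (Poly_Mapping.lookup m)}"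
  (is "?L = ?R")
proof
  note mod = vector_space_const_mpoly[unfolded module_iff_vector_space[symmetric]]
  show "?L \<subseteq> ?R"
    unfolding lin_span_def
  proof (rule module.span_minimal[OF mod])
    show "{xpow c | c. Q c} \<subseteq> ?R"
    proof safe
      fix c m assume "Q c" "m \<in> Poly_Mapping.keys (xpow c :: ('v, 'k) mpoly)"
      moreover obtain m' where "c = Poly_Mapping.lookup m'" using ex_lookup_eq by metis
      ultimately show "Q (Poly_Mapping.lookup m)" by (simp add: xpow_lookup)
    qed
    show "module.subspace (\<lambda>a p. const_mpoly a * p) ?R"
    proof (rule module.subspaceI[OF mod])
      show "0 \<in> ?R" by simp
    next
      fix p q assume "p \<in> ?R" "q \<in> ?R"
      then show "p + q \<in> ?R" using Poly_Mapping.keys_add[of p q] by blast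
    next
      fix a p assume "p \<in> ?R"
      moreover have "Poly_Mapping.keys (const_mpoly a * p) \<subseteq> Poly_Mapping.keys p"
        by (auto simp: const_mpoly_def elim!: keys_multE split: if_splits)
      ultimately show "const_mpoly a * p \<in> ?R" by blast
    qed
  qed
  show "?R \<subseteq> ?L"
  proof
    fix p assume "p \<in> ?R"
    then have "(\<Sum>m\<in>Poly_Mapping.keys p. const_mpoly (Poly_Mapping.lookup p m) * xpow (Poly_Mapping.lookup m)) \<in> ?L"
      unfolding lin_span_def
      by (intro module.span_sum[OF mod] module.span_scale[OF mod] module.span_base[OF mod]) auto
    then show "p \<in> ?L" unfolding xpow_lookup mpoly_eq_sum_monomials[symmetric] .
  qed
qed

text \<open>
  The convention $J_0 = S$ fits the description by covers, since the bound for $k = 0$ is void.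
\<close>
lemma A_alg_eq_monomial_algebra:
  fixes E \<Delta> :: "'v::finite set set"
  assumes "simple_graph E"
    and "(facet_ideal \<Delta> :: ('v, 'k::field) mpoly set) = cover_ideal E"
  shows "(A_alg \<Delta> :: ('v, 'k) mpoly poly set) = monomial_algebra (min_cover_ge E)"
proof -
  have "(J_ideal \<Delta> k :: ('v, 'k) mpoly set) =
      {p. \<forall>m\<in>Poly_Mapping.keys p. min_cover_ge E k (Poly_Mapping.lookup m)}" for k
  proof (cases "k = 0")
    case False
    then show ?thesis
      by (simp add: J_ideal_def lin_span_monomials is_cover_iff_min_cover_ge[OF assms])
  qed (simp add: J_ideal_def min_cover_ge_def)
  then show ?thesis by (simp add: A_alg_def monomial_algebra_def)
qed

text \<open>
  Each edge of a packing splits off a factor $x_e t$.  So \<open>monomial_algebra (packs E)\<close> is the Rees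
  algebra of the edge ideal, generated in degree one by the edges.
\<close>
lemma packing_algebra_subset:
  fixes R :: "('v::finite, 'k::field) mpoly poly set"
  assumes "S_subalgebra R" and edges: "\<And>e. e \<in> E \<Longrightarrow> monom (xset e) 1 \<in> R"
  shows "monomial_algebra (packs E) \<subseteq> R"
proof (rule monomial_algebra_subset[OF assms(1)])
  fix k c assume "packs E k c"
  then show "monom (xpow c) k \<in> R"
  proof induction
    case (packs_0 c)
    then show ?case using assms(1) by (simp add: S_subalgebra_def monom_0)
  next
    case (packs_Suc e k c)
    then have "monom (xpow c) k * monom (xset e) 1 \<in> R"
      using assms(1) edges unfolding S_subalgebra_def by blast
    also have "monom (xpow c) k * monom (xset e) 1 =
        (monom (xpow (\<lambda>v. c v + of_bool (v \<in> e))) (Suc k) :: ('v, 'k) mpoly poly)"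
      by (simp add: mult_monom xset_eq_xpow xpow_def power_add prod.distrib)
    finally show ?case .
  qed
qed

section \<open>Standard gradedness\<close>

text \<open>
  An algebra between the Rees algebra of the edge ideal and the algebra of all covers has the edge
  ideal as its part of degree one, because packings and covers agree there.  This part generates the
  Rees algebra, whatever the rest of the algebra is.
\<close>
lemma standard_graded_iff_eq_packing_algebra:
  fixes R :: "('v::finite, 'k::field) mpoly poly set"
  assumes "monomial_algebra (packs E) \<subseteq> R" "R \<subseteq> monomial_algebra (min_cover_ge E)"
  shows "standard_graded R \<longleftrightarrow> R = monomial_algebra (packs E)"
proof -
  let ?T = "monomial_algebra (packs E) :: ('v, 'k) mpoly poly set"
  have "{p \<in> R. \<exists>f. p = monom f 1} \<subseteq> ?T"
  proof safe
    fix f assume "monom f 1 \<in> R"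
    then have f: "min_cover_ge E 1 (Poly_Mapping.lookup m)" if "m \<in> Poly_Mapping.keys f" for m
      using assms(2) that by (force simp: monomial_algebra_def)
    have "packs E k (Poly_Mapping.lookup m)" if "m \<in> Poly_Mapping.keys (coeff (monom f 1) k)" for k m
    proof -
      have "k = 1" "m \<in> Poly_Mapping.keys f" using that by (auto split: if_splits)
      then show ?thesis using packs_1_if_min_cover_ge f by blast
    qed
    then show "monom f 1 \<in> ?T" by (simp add: monomial_algebra_def)
  qed
  moreover have "S_subalgebra ?T"
    by (rule S_subalgebra_monomial_algebra) (auto intro: packs.packs_0 packs_add)
  ultimately have "S_subalgebra_gen {p \<in> R. \<exists>f. p = monom f 1} \<subseteq> ?T"
    unfolding S_subalgebra_gen_def by (intro hull_minimal)
  moreover have "?T \<subseteq> S_subalgebra_gen {p \<in> R. \<exists>f. p = monom f 1}"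
  proof (rule packing_algebra_subset[OF S_subalgebra_gen_is_S_subalgebra])
    fix e assume "e \<in> E"
    then have "packs E 1 (\<lambda>v. of_bool (v \<in> e))"
      using packs.packs_Suc[OF _ packs.packs_0, of e E "\<lambda>_. 0"] by simp
    then have "monom (xset e) 1 \<in> R"
      using assms(1) by (auto simp: xset_eq_xpow monom_xpow_mem_monomial_algebra_iff)
    then show "monom (xset e) 1 \<in> S_subalgebra_gen {p \<in> R. \<exists>f. p = monom f 1}"
      unfolding S_subalgebra_gen_def by (intro hull_inc) auto
  qed
  ultimately show ?thesis unfolding standard_graded_def by blast
qed

theorem proposition2p4:
  fixes E \<Delta> :: "'v::finite set set"
  assumes "simple_graph E"
    and "abstract_simplicial_complex \<Delta>"
    and "(facet_ideal \<Delta> :: ('v, 'k::field) mpoly set) = cover_ideal E"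
  shows "standard_graded (B_alg \<Delta> :: ('v, 'k) mpoly poly set) \<longleftrightarrow>
         standard_graded (A_alg \<Delta> :: ('v, 'k) mpoly poly set)"
proof -
  let ?A = "A_alg \<Delta> :: ('v, 'k) mpoly poly set"
  let ?B = "B_alg \<Delta> :: ('v, 'k) mpoly poly set"
  let ?T = "monomial_algebra (packs E) :: ('v, 'k) mpoly poly set"
  note A = A_alg_eq_monomial_algebra[OF assms(1,3)]
  have B_gen: "monom (xpow c) k \<in> ?B" if "1 \<le> k" "min_cover_ge E k c" "squarefree_vec c" for c k
    using that is_cover_iff_min_cover_ge[OF assms(1,3), of k c]
    unfolding B_alg_def S_subalgebra_gen_def by (intro hull_inc) auto
  have TB: "?T \<subseteq> ?B"
  proof (rule packing_algebra_subset)
    show "S_subalgebra ?B"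
      unfolding B_alg_def by (rule S_subalgebra_gen_is_S_subalgebra)
    fix e assume "e \<in> E"
    then have "min_cover_ge E 1 (\<lambda>v. of_bool (v \<in> e))"
      using min_cover_ge_if_packs packs.packs_Suc[OF _ packs.packs_0, of e E "\<lambda>_. 0"] by fastforce
    then show "monom (xset e) 1 \<in> ?B"
      unfolding xset_eq_xpow by (intro B_gen) (auto simp: squarefree_vec_def)
  qed
  have "S_subalgebra ?A"
    unfolding A
  proof (rule S_subalgebra_monomial_algebra)
    show "min_cover_ge E (k + l) (\<lambda>v. c v + d v)"
      if "min_cover_ge E k c" "min_cover_ge E l d" for k l c d
      using that by (simp add: min_cover_ge_def sum.distrib add_mono)
  qed (simp add: min_cover_ge_def)
  then have BA: "?B \<subseteq> ?A"
    unfolding B_alg_def S_subalgebra_gen_def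
    by (intro hull_minimal)
      (auto simp: A monom_xpow_mem_monomial_algebra_iff is_cover_iff_min_cover_ge[OF assms(1,3)])
  have "?A = ?T" if "?B = ?T"
  proof -
    have "packs E k c" if "squarefree_vec c" "min_cover_ge E k c" for k c
    proof (cases "k = 0")
      case False
      then have "monom (xpow c) k \<in> ?T" using B_gen that \<open>?B = ?T\<close> by simp
      then show ?thesis by (simp add: monom_xpow_mem_monomial_algebra_iff)
    qed (simp add: packs.packs_0)
    then obtain C where "bipartition E C"
      using bipartition_if_squarefree_packs[OF assms(1)] by blast
    then have "min_cover_ge E = packs E"
      using weighted_Koenig min_cover_ge_if_packs by blast
    then show ?thesis by (simp add: A)
  qed
  then show ?thesis
    using standard_graded_iff_eq_packing_algebra[of E ?A]
      standard_graded_iff_eq_packing_algebra[of E ?B] TB BA A by blast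
qed

end
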